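(* Let $F$ be a finite extension of $\mathbb{Q}_p$ with residue field of cardinality $q$, let $G=\mathrm{SL}_2(F)$, let $M$ be the diagonal subgroup, and let $i$ be the map on degree-zero Hochschild homology induced by normalised parabolic induction from $M$ to $G$ along the upper-triangular subgroup $P$. On the unramified principal-series component, identified as in the context with $\mathcal{H}(\Lambda)=\mathbb{C}[\lambda,\lambda^{-1}]$ on the $M$ side and with $\mathrm{HH}_0(\mathcal{A})$ on the $G$ side ($\mathcal{A}$ the Iwahori–Hecke algebra), the commutator $1_{G_c}i-i1_{M_c}:\mathcal{H}(\Lambda)\to\mathrm{HH}_0(\mathcal{A})$ is given by $$(1_{G_c}i-i1_{M_c})(\lambda^n)=\frac{R_{1,(st)^n}}{q^n(q-1)}\left(q-1-T_s-T_t\right)\qquad\text{for } n\geq 1,$$ where $R_{1,(st)^n}=(q-1)(q^{2n-1}-q^{2n-2}+q^{2n-3}-\cdots-1)$. The commutator vanishes on $\lambda^n$ for $n<1$.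
   Context: $\mathcal{H}(G)$ is the algebra of locally constant, compactly supported functions $G\to\mathbb{C}$ under convolution; $\mathrm{HH}_0(A)=A/[A,A]$ for an algebra $A$. $G_c$ is the union of the compact subgroups of $G$, and $1_{G_c}$ acts on $\mathrm{HH}_0(\mathcal{H}(G))$ by pointwise multiplication of functions by the characteristic function of $G_c$; similarly $1_{M_c}$ on $\mathrm{HH}_0(\mathcal{H}(M))$. Let $M^\circ$ be the maximal compact subgroup of $M$, and $\Lambda=M/M^\circ\cong\mathbb{Z}$. Let $\delta_P$ be the modular function of $P$, with the convention $d(pq)=\delta_P(q)\,dp$ for a left Haar measure $dp$ (so $\delta_P(\mathrm{diag}(a,a^{-1}))=|a|^{-2}$), and let $\chi$ be the characteristic function of $\{m\in M\mid\delta_P(m)>1\}$. Let $\lambda\in\Lambda$ be the generator with $\chi(\lambda)=1$; then $\mathcal{H}(\Lambda)=\mathbb{C}[\lambda,\lambda^{-1}]$. If $E_1$ denotes projection onto the component of representations of $M$ on which $M^\circ$ acts trivially, then $E_1\mathrm{HH}_0(\mathcal{H}(M))\cong\mathcal{H}(\Lambda)$. The functor of normalised parabolic induction sends this component into the unramified principal-series component of the category of finitely generated smooth representations of $G$. The latter component is equivalent (via invariants under an Iwahori subgroup) to the category of finitely generated modules over the Iwahori–Hecke algebra $\mathcal{A}=\mathrm{span}_{\mathbb{C}}\{T_w\mid w\in W\}$ of the affine Weyl group $W=\langle s,t\mid s^2=t^2=1\rangle$, with multiplication $T_wT_{w'}=T_{ww'}$ if $\ell(ww')=\ell(w)+\ell(w')$,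 $T_s^2=(q-1)T_s+q$, $T_t^2=(q-1)T_t+q$, where $\ell$ is the length function. So the corresponding component of $\mathrm{HH}_0(\mathcal{H}(G))$ is identified with $\mathrm{HH}_0(\mathcal{A})=\mathcal{A}/[\mathcal{A},\mathcal{A}]$, which has basis $\{T_s,T_t,T_{(st)^n}\mid n\geq 0\}$ (classes modulo commutators; $T_1=1$). Under these identifications: the map $i$ is the one induced by the algebra homomorphism $i:\mathcal{H}(\Lambda)\to\mathcal{A}$, $i(\lambda)=qT_{ts}^{-1}$, and the map $\overline{i}$ of normalised parabolic induction along the lower-triangular subgroup is induced by the algebra homomorphism $\overline{i}(\lambda)=q^{-1}T_{st}$; the operator $1_{M_c}$ on $\mathcal{H}(\Lambda)$ fixes $\lambda^0=1$ and kills $\lambda^n$ for $n\neq 0$; and the operator $1_{G_c}$ on $\mathrm{HH}_0(\mathcal{A})$ is given by $1_{G_c}(T_s)=T_s$, $1_{G_c}(T_t)=T_t$, $1_{G_c}(1)=1$, and $1_{G_c}(T_{(st)^n})=0$ for $n\geq 1$. *)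

theory Defs
  imports "HOL-Analysis.Analysis" "HOL-Library.Poly_Mapping"
begin

section \<open>Finite extensions of the p-adic numbers\<close>

text \<open>The closure of the rational numbers in a valued field; in a complete field whose absolute
  value restricts to the p-adic one this is (a copy of) the field of p-adic numbers.\<close>

definition rational_closure :: "('f::field \<Rightarrow> real) \<Rightarrow> 'f set" where
  "rational_closure v = {x. \<forall>e>0. \<exists>a b :: int. b \<noteq> 0 \<and> v (x - of_int a / of_int b) < e}"

text \<open>The absolute value \<open>v\<close> is normalised so as to extend the p-adic absolute value of the rational
  numbers (axiom \<open>v_of_int\<close>, which also forces characteristic zero). It is determined by the field,
  and it is used only to speak about the ring of integers.\<close>

locale padic_field =
  fixes p :: nat and v :: "'f::field \<Rightarrow> real"
  assumes prime_p: "prime p"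
    and v_nonneg: "v x \<ge> 0"
    and v_eq_0_iff: "v x = 0 \<longleftrightarrow> x = 0"
    and v_mult: "v (x * y) = v x * v y"
    and v_add: "v (x + y) \<le> max (v x) (v y)"
    and v_of_int: "n \<noteq> 0 \<Longrightarrow> v (of_int n) = (1 / real p) ^ multiplicity (int p) n"
    and v_complete: "(\<forall>e>0. \<exists>N. \<forall>m\<ge>N. \<forall>n\<ge>N. v (X m - X n) < e)
          \<Longrightarrow> \<exists>l. \<forall>e>0. \<exists>N::nat. \<forall>n\<ge>N. v (X n - l) < e"
    and finite_degree: "\<exists>B. finite B \<and>
          (\<forall>x. \<exists>c. (\<forall>b\<in>B. c b \<in> rational_closure v) \<and> x = (\<Sum>b\<in>B. c b * b))"

definition residue_field :: "('f::field \<Rightarrow> real) \<Rightarrow> 'f set set" where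
  "residue_field v = {x. v x \<le> 1} // {(x, y). v x \<le> 1 \<and> v y \<le> 1 \<and> v (x - y) < 1}"


section \<open>Complex algebras and their zeroth Hochschild homology\<close>

class scaleC =
  fixes scaleC :: "complex \<Rightarrow> 'a \<Rightarrow> 'a"  (infixr "*\<^sub>C" 75)

class complex_vector = scaleC + ab_group_add +
  assumes scaleC_add_right: "a *\<^sub>C (x + y) = a *\<^sub>C x + a *\<^sub>C y"
    and scaleC_add_left: "(a + b) *\<^sub>C x = a *\<^sub>C x + b *\<^sub>C x"
    and scaleC_scaleC: "a *\<^sub>C (b *\<^sub>C x) = (a * b) *\<^sub>C x"
    and scaleC_one: "1 *\<^sub>C x = x"

class complex_algebra_1 = complex_vector + ring_1 +
  assumes mult_scaleC_left: "(a *\<^sub>C x) * y = a *\<^sub>C (x * y)"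
    and mult_scaleC_right: "x * (a *\<^sub>C y) = a *\<^sub>C (x * y)"

global_interpretation complex_vector:
    vector_space "scaleC :: complex \<Rightarrow> 'a \<Rightarrow> 'a::complex_vector"
  by unfold_locales (simp_all add: scaleC_add_right scaleC_add_left scaleC_scaleC scaleC_one)

global_interpretation complex_vector:
    vector_space_pair "scaleC :: complex \<Rightarrow> 'a \<Rightarrow> 'a::complex_vector"
      "scaleC :: complex \<Rightarrow> 'b \<Rightarrow> 'b::complex_vector"
  by unfold_locales

abbreviation clinear :: "('a::complex_vector \<Rightarrow> 'b::complex_vector) \<Rightarrow> bool" where
  "clinear \<equiv> Vector_Spaces.linear scaleC scaleC"

lemma clinear_iff:
  "clinear f \<longleftrightarrow> (\<forall>x y. f (x + y) = f x + f y) \<and> (\<forall>a x. f (a *\<^sub>C x) = a *\<^sub>C f x)"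
  by (simp add: Vector_Spaces.linear_iff complex_vector.vector_space_axioms)

definition algebra_hom :: "('a::complex_algebra_1 \<Rightarrow> 'b::complex_algebra_1) \<Rightarrow> bool" where
  "algebra_hom f \<longleftrightarrow> clinear f \<and> f 1 = 1 \<and> (\<forall>x y. f (x * y) = f x * f y)"

definition is_ring_inverse :: "'a::ring_1 \<Rightarrow> 'a \<Rightarrow> bool" where
  "is_ring_inverse x y \<longleftrightarrow> x * y = 1 \<and> y * x = 1"

definition ring_inverse :: "'a::ring_1 \<Rightarrow> 'a" where
  "ring_inverse x = (THE y. is_ring_inverse x y)"

definition commutator_space :: "'a::complex_algebra_1 set" where
  "commutator_space = complex_vector.span {x * y - y * x | x y. True}"

quotient_type (overloaded) 'a HH0 = "'a::complex_algebra_1" / "\<lambda>x y. x - y \<in> commutator_space"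
proof (rule equivpI)
  show "reflp (\<lambda>x y::'a. x - y \<in> commutator_space)"
    by (simp add: reflp_def commutator_space_def complex_vector.span_zero)
  show "symp (\<lambda>x y::'a. x - y \<in> commutator_space)"
  proof (rule sympI)
    fix x y :: 'a
    assume "x - y \<in> commutator_space"
    then show "y - x \<in> commutator_space"
      unfolding commutator_space_def by (auto dest: complex_vector.span_neg)
  qed
  show "transp (\<lambda>x y::'a. x - y \<in> commutator_space)"
  proof (rule transpI)
    fix x y z :: 'a
    assume "x - y \<in> commutator_space" "y - z \<in> commutator_space"
    then show "x - z \<in> commutator_space"
      unfolding commutator_space_def by - (drule (1) complex_vector.span_add, simp)
  qed
qed

lift_definition HH0_class :: "'a::complex_algebra_1 \<Rightarrow> 'a HH0" is "\<lambda>x. x" .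

instantiation HH0 :: (complex_algebra_1) complex_vector
begin

lift_definition zero_HH0 :: "'a HH0" is 0 .

lift_definition plus_HH0 :: "'a HH0 \<Rightarrow> 'a HH0 \<Rightarrow> 'a HH0" is "(+)"
  unfolding commutator_space_def
  by (drule (1) complex_vector.span_add) (simp add: algebra_simps)

lift_definition minus_HH0 :: "'a HH0 \<Rightarrow> 'a HH0 \<Rightarrow> 'a HH0" is "(-)"
  unfolding commutator_space_def
  by (drule (1) complex_vector.span_diff) (simp add: algebra_simps)

lift_definition uminus_HH0 :: "'a HH0 \<Rightarrow> 'a HH0" is uminus
  unfolding commutator_space_def
  by (drule complex_vector.span_neg) (simp add: algebra_simps)

lift_definition scaleC_HH0 :: "complex \<Rightarrow> 'a HH0 \<Rightarrow> 'a HH0" is scaleC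
  unfolding commutator_space_def
  by (drule complex_vector.span_scale) (simp add: complex_vector.scale_right_diff_distrib)

instance
proof
  have E: "x = y \<Longrightarrow> x - y \<in> commutator_space" for x y :: 'a
    by (simp add: commutator_space_def complex_vector.span_zero)
  fix a b :: complex and x y z :: "'a HH0"
  show "a *\<^sub>C (x + y) = a *\<^sub>C x + a *\<^sub>C y"
    by transfer (rule E, rule scaleC_add_right)
  show "(a + b) *\<^sub>C x = a *\<^sub>C x + b *\<^sub>C x"
    by transfer (rule E, rule scaleC_add_left)
  show "a *\<^sub>C b *\<^sub>C x = (a * b) *\<^sub>C x"
    by transfer (rule E, rule scaleC_scaleC)
  show "1 *\<^sub>C x = x"
    by transfer (rule E, rule scaleC_one)
  show "x + y + z = x + (y + z)"
    by transfer (rule E, rule add.assoc)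
  show "x + y = y + x"
    by transfer (rule E, rule add.commute)
  show "0 + x = x"
    by transfer (rule E, rule add_0)
  show "- x + x = 0"
    by transfer (rule E, rule left_minus)
  show "x - y = x + - y"
    by transfer (rule E, rule diff_conv_add_uminus)
qed

end

lemma HH0_class_eq_iff: "HH0_class x = HH0_class y \<longleftrightarrow> x - y \<in> commutator_space"
  by transfer (rule refl)

lemma HH0_class_add: "HH0_class (x + y) = HH0_class x + HH0_class y"
  by (rule plus_HH0.abs_eq[folded HH0_class.abs_eq, symmetric])

lemma HH0_class_scaleC: "HH0_class (a *\<^sub>C x) = a *\<^sub>C HH0_class x"
  by (rule scaleC_HH0.abs_eq[folded HH0_class.abs_eq, symmetric])

lemma clinear_HH0_class: "clinear HH0_class"
  by (simp add: clinear_iff HH0_class_add HH0_class_scaleC)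

lemma HH0_class_surj: "\<exists>x. h = HH0_class x"
  by (induction h rule: HH0.abs_induct) (metis HH0_class.abs_eq)

lemma HH0_class_commute: "HH0_class (x * y) = HH0_class (y * x)"
  unfolding HH0_class_eq_iff commutator_space_def
  by (rule complex_vector.span_base) blast


section \<open>The algebra of Laurent polynomials\<close>

instantiation complex :: complex_algebra_1
begin
definition scaleC_complex :: "complex \<Rightarrow> complex \<Rightarrow> complex" where
  "scaleC_complex a x = a * x"
instance by standard (simp_all add: scaleC_complex_def algebra_simps)
end

instantiation poly_mapping :: (type, complex_vector) complex_vector
begin
definition scaleC_poly_mapping :: "complex \<Rightarrow> ('a \<Rightarrow>\<^sub>0 'b) \<Rightarrow> ('a \<Rightarrow>\<^sub>0 'b)" where
  "scaleC_poly_mapping a = Poly_Mapping.map (scaleC a)"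

lemma lookup_scaleC: "Poly_Mapping.lookup (a *\<^sub>C f) k = a *\<^sub>C Poly_Mapping.lookup f k" for f :: "'a \<Rightarrow>\<^sub>0 'b"
  by (simp add: scaleC_poly_mapping_def Poly_Mapping.map.rep_eq when_def)

instance
  by standard (rule poly_mapping_eqI; simp add: lookup_scaleC lookup_add
      scaleC_add_right scaleC_add_left scaleC_scaleC scaleC_one)+
end

lemma scaleC_single: "a *\<^sub>C Poly_Mapping.single k c = Poly_Mapping.single k (a *\<^sub>C c)"
  by (intro poly_mapping_eqI) (auto simp: lookup_scaleC lookup_single when_def)

lemma poly_mapping_additive_induct [case_names zero plus]:
  fixes f :: "'a \<Rightarrow>\<^sub>0 'b::comm_monoid_add"
  assumes zero: "P 0" and plus: "\<And>f k c. P f \<Longrightarrow> P (f + Poly_Mapping.single k c)"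
  shows "P f"
proof (induction f rule: update_induct)
  case const
  then show ?case by (fact zero)
next
  case (update f k c)
  have "Poly_Mapping.update k c f = f + Poly_Mapping.single k c"
    using update(1) by (intro poly_mapping_eqI)
      (auto simp: lookup_update lookup_add lookup_single when_def in_keys_iff)
  then show ?case
    using plus[OF update(3)] by simp
qed

instance poly_mapping :: (monoid_add, complex_algebra_1) complex_algebra_1
proof
  fix a :: complex and x y :: "'a \<Rightarrow>\<^sub>0 'b"
  have L: "a *\<^sub>C f = Poly_Mapping.single 0 (a *\<^sub>C 1) * f" for f :: "'a \<Rightarrow>\<^sub>0 'b"
    by (induction f rule: poly_mapping_additive_induct)
      (simp_all add: scaleC_add_right distrib_left scaleC_single mult_single mult_scaleC_left)
  have R: "a *\<^sub>C f = f * Poly_Mapping.single 0 (a *\<^sub>C 1)" for f :: "'a \<Rightarrow>\<^sub>0 'b"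
    by (induction f rule: poly_mapping_additive_induct)
      (simp_all add: scaleC_add_right distrib_right scaleC_single mult_single mult_scaleC_right)
  show "(a *\<^sub>C x) * y = a *\<^sub>C (x * y)"
    by (simp only: L mult.assoc)
  show "x * (a *\<^sub>C y) = a *\<^sub>C (x * y)"
    by (simp only: R mult.assoc)
qed

text \<open>Multiplication of finitely supported functions is convolution, so this is the group algebra of
  the infinite cyclic group of diagonal matrices of SL(2,F) modulo the compact ones; the element \<open>\<lambda>\<^sup>n\<close> is the function supported at \<open>n\<close>.\<close>

type_synonym laurent = "int \<Rightarrow>\<^sub>0 complex"

definition lam_pow :: "int \<Rightarrow> laurent" where
  "lam_pow n = Poly_Mapping.single n 1"

definition one_Mc :: "laurent \<Rightarrow> laurent" where
  "one_Mc f = Poly_Mapping.single 0 (Poly_Mapping.lookup f 0)"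


section \<open>The affine Weyl group\<close>

datatype gen = Gs | Gt

text \<open>The group with presentation \<open>\<langle>s, t | s\<^sup>2 = t\<^sup>2 = 1\<rangle>\<close>: words modulo cancellation. Since the
  generators are involutions, no formal inverses are needed.\<close>

inductive word_eq :: "gen list \<Rightarrow> gen list \<Rightarrow> bool" where
  refl: "word_eq u u"
| sym: "word_eq u w \<Longrightarrow> word_eq w u"
| trans: "word_eq u w \<Longrightarrow> word_eq w x \<Longrightarrow> word_eq u x"
| cancel: "word_eq (u @ a # a # w) (u @ w)"

quotient_type weyl = "gen list" / word_eq
  by (intro equivpI reflpI sympI transpI) (blast intro: word_eq.intros)+

lift_definition word :: "gen list \<Rightarrow> weyl" is "\<lambda>u. u" .

lemma word_eq_append_left: "word_eq u w \<Longrightarrow> word_eq (x @ u) (x @ w)"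
proof (induction rule: word_eq.induct)
  case (cancel u a w)
  then show ?case using word_eq.cancel[of "x @ u" a w] by simp
qed (blast intro: word_eq.refl word_eq.sym word_eq.trans)+

lemma word_eq_append_right: "word_eq u w \<Longrightarrow> word_eq (u @ x) (w @ x)"
proof (induction rule: word_eq.induct)
  case (cancel u a w)
  then show ?case using word_eq.cancel[of u a "w @ x"] by simp
qed (blast intro: word_eq.refl word_eq.sym word_eq.trans)+

instantiation weyl :: monoid_mult
begin

lift_definition one_weyl :: weyl is "[]" .

lift_definition times_weyl :: "weyl \<Rightarrow> weyl \<Rightarrow> weyl" is "(@)"
  by (blast intro: word_eq.trans word_eq_append_left word_eq_append_right)

instance
  by standard (transfer; simp add: word_eq.refl)+

end

definition gs :: weyl where "gs = word [Gs]"
definition gt :: weyl where "gt = word [Gt]"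

definition len :: "weyl \<Rightarrow> nat" where
  "len w = (LEAST n. \<exists>u. word u = w \<and> length u = n)"


section \<open>The Iwahori--Hecke algebra\<close>

text \<open>A complex algebra \<^typ>\<open>'a\<close> together with a family \<open>T\<close> is the Iwahori--Hecke algebra with
  parameter \<open>q\<close> and its standard basis.\<close>

locale iwahori_hecke =
  fixes q :: nat and T :: "weyl \<Rightarrow> 'a::complex_algebra_1"
  assumes inj_T: "inj T"
    and independent_T: "complex_vector.independent (range T)"
    and span_T: "complex_vector.span (range T) = UNIV"
    and T_one: "T 1 = 1"
    and T_mult: "len (w * w') = len w + len w' \<Longrightarrow> T w * T w' = T (w * w')"
    and T_quadratic_s: "T gs * T gs = (of_nat q - 1) *\<^sub>C T gs + of_nat q *\<^sub>C 1"
    and T_quadratic_t: "T gt * T gt = (of_nat q - 1) *\<^sub>C T gt + of_nat q *\<^sub>C 1"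

text \<open>Existence and uniqueness of these two maps are \<open>ind_hom_exists_unique\<close> and
  \<open>one_Gc_exists_unique\<close> below.\<close>

definition ind_hom :: "nat \<Rightarrow> (weyl \<Rightarrow> 'a::complex_algebra_1) \<Rightarrow> laurent \<Rightarrow> 'a" where
  "ind_hom q T = (THE \<phi>. algebra_hom \<phi> \<and>
     \<phi> (lam_pow 1) = of_nat q *\<^sub>C ring_inverse (T (gt * gs)))"

definition one_Gc :: "(weyl \<Rightarrow> 'a::complex_algebra_1) \<Rightarrow> 'a HH0 \<Rightarrow> 'a HH0" where
  "one_Gc T = (THE f. clinear f \<and>
     f (HH0_class (T gs)) = HH0_class (T gs) \<and>
     f (HH0_class (T gt)) = HH0_class (T gt) \<and>
     f (HH0_class (T 1)) = HH0_class (T 1) \<and>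
     (\<forall>n\<ge>1. f (HH0_class (T ((gs * gt) ^ n))) = 0))"

text \<open>The algebra of Laurent polynomials is commutative, so it is its own zeroth Hochschild homology.\<close>

definition ind :: "nat \<Rightarrow> (weyl \<Rightarrow> 'a::complex_algebra_1) \<Rightarrow> laurent \<Rightarrow> 'a HH0" where
  "ind q T f = HH0_class (ind_hom q T f)"

definition R_poly :: "nat \<Rightarrow> nat \<Rightarrow> complex" where
  "R_poly q n = (of_nat q - 1) * (\<Sum>j<2*n. (- 1) ^ j * of_nat q ^ (2 * n - 1 - j))"


section \<open>Well-definedness of the maps\<close>

fun cons_red :: "gen \<Rightarrow> gen list \<Rightarrow> gen list" where
  "cons_red a [] = [a]"
| "cons_red a (b # w) = (if a = b then w else a # b # w)"

definition red :: "gen list \<Rightarrow> gen list" where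
  "red u = foldr cons_red u []"

lemma cons_red_cons_red: "distinct_adj w \<Longrightarrow> cons_red a (cons_red a w) = w"
  by (cases w; cases "tl w") auto

lemma distinct_adj_cons_red: "distinct_adj w \<Longrightarrow> distinct_adj (cons_red a w)"
  by (cases w; cases "tl w") auto

lemma distinct_adj_foldr: "distinct_adj w \<Longrightarrow> distinct_adj (foldr cons_red u w)"
  by (induction u) (auto intro: distinct_adj_cons_red)

lemma distinct_adj_red: "distinct_adj (red u)"
  by (simp add: red_def distinct_adj_foldr)

lemma word_eq_imp_red_eq: "word_eq u w \<Longrightarrow> red u = red w"
proof (induction rule: word_eq.induct)
  case (cancel u a w)
  have "foldr cons_red (a # a # w) [] = foldr cons_red w []"
    using cons_red_cons_red[OF distinct_adj_red, of a w] by (simp add: red_def)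
  then show ?case
    unfolding red_def foldr_append by simp
qed auto

lemma red_distinct_adj: "distinct_adj u \<Longrightarrow> red u = u"
proof (induction u)
  case (Cons a u)
  then have "red (a # u) = cons_red a u"
    by (cases u) (auto simp: red_def)
  then show ?case using Cons.prems by (cases u) auto
qed (simp add: red_def)

lemma length_red: "length (red u) \<le> length u"
proof (induction u)
  case (Cons a u)
  have "length (cons_red a w) \<le> Suc (length w)" for w
    by (cases w) auto
  from this[of "red u"] Cons show ?case by (simp add: red_def)
qed (simp add: red_def)

lift_definition nf :: "weyl \<Rightarrow> gen list" is red
  by (rule word_eq_imp_red_eq)

lemma nf_word: "nf (word u) = red u"
  by transfer simp

lemma word_cons_red: "word (cons_red a w) = word (a # w)"
proof (cases w)
  case (Cons b u)
  have "word_eq (a # a # u) u"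
    using word_eq.cancel[of "[]" a u] by simp
  then show ?thesis
    using Cons by (auto simp: word.abs_eq weyl.abs_eq_iff intro: word_eq.sym word_eq.refl)
qed simp

lemma word_append: "word (u @ w) = word u * word w"
  by (simp add: word.abs_eq times_weyl.abs_eq)

lemma word_Nil: "word [] = 1"
  by (simp add: word.abs_eq one_weyl_def)

lemma word_red: "word (red u) = word u"
proof (induction u)
  case (Cons a u)
  have "word (red (a # u)) = word ([a] @ red u)"
    by (simp add: red_def word_cons_red)
  also have "\<dots> = word (a # u)"
    using Cons word_append[of "[a]"] by (metis append_Cons append_Nil)
  finally show ?case .
qed (simp add: red_def)

lemma word_surj: "\<exists>u. w = word u"
  by (induction w rule: weyl.abs_induct) (metis word.abs_eq)

lemma word_nf: "word (nf w) = w"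
  using word_surj[of w] by (auto simp: nf_word word_red)

lemma distinct_adj_nf: "distinct_adj (nf w)"
  using word_surj[of w] by (auto simp: nf_word distinct_adj_red)

lemma len_word: "distinct_adj u \<Longrightarrow> len (word u) = length u"
  unfolding len_def
proof (rule Least_equality)
  fix n
  assume "distinct_adj u" "\<exists>w. word w = word u \<and> length w = n"
  then show "length u \<le> n"
    by (metis length_red nf_word red_distinct_adj)
qed blast

lemma gen_neq_imp_eq: "a \<noteq> b \<Longrightarrow> c \<noteq> b \<Longrightarrow> a = (c::gen)"
  by (cases a; cases b; cases c) auto

lemma even_length_iff_hd_last:
  "distinct_adj u \<Longrightarrow> u \<noteq> [] \<Longrightarrow> even (length u) \<longleftrightarrow> hd u \<noteq> (last u :: gen)"
proof (induction u)
  case (Cons a u)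
  then show ?case
    using gen_neq_imp_eq[of a "hd u" "last u"] by (cases u) auto
qed simp

lemma word_even:
  "distinct_adj u \<Longrightarrow> even (length u) \<Longrightarrow> u \<noteq> [] \<Longrightarrow> hd u = Gs
    \<Longrightarrow> word u = (gs * gt) ^ (length u div 2)"
proof (induction u rule: induct_list012)
  case (3 a b u)
  then have ab: "a = Gs" "b = Gt"
    using gen.exhaust[of b] by auto
  have "word u = (gs * gt) ^ (length u div 2)"
  proof (cases u)
    case (Cons c w)
    then have "c = Gs" using 3 ab gen.exhaust[of c] by auto
    then show ?thesis using 3 Cons by auto
  qed (simp add: word_Nil)
  moreover have "word (a # b # u) = gs * gt * word u"
    using word_append[of "[a]" "b # u"] word_append[of "[b]" u] ab
    by (simp add: gs_def gt_def mult.assoc)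
  ultimately show ?case by simp
qed auto

lemma distinct_adj_alt_exists: "\<exists>u. distinct_adj u \<and> length u = 2 * n \<and> (n > 0 \<longrightarrow> hd u = Gs)"
proof (induction n)
  case (Suc n)
  then obtain u where u: "distinct_adj u" "length u = 2 * n" "n > 0 \<longrightarrow> hd u = Gs" by blast
  show ?case
    by (rule exI[of _ "Gs # Gt # u"]) (use u in \<open>cases u; auto\<close>)
qed simp

context iwahori_hecke
begin

abbreviation Tw :: "gen list \<Rightarrow> 'a" where "Tw u \<equiv> T (word u)"

lemma Tw_Nil: "Tw [] = 1"
  by (simp add: word_Nil T_one)

lemma Tw_append: "distinct_adj (u @ w) \<Longrightarrow> Tw u * Tw w = Tw (u @ w)"
  unfolding word_append
  by (rule T_mult) (auto simp: len_word distinct_adj_append_iff simp flip: word_append)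

lemma Tw_quadratic: "Tw [a] * Tw [a] = (of_nat q - 1) *\<^sub>C Tw [a] + of_nat q *\<^sub>C 1"
  using T_quadratic_s T_quadratic_t by (cases a) (simp_all add: gs_def gt_def)

lemma Tw_left: "distinct_adj (a # u) \<Longrightarrow> Tw [a] * Tw u = Tw (a # u)"
  using Tw_append[of "[a]" u] by simp

lemma Tw_right: "distinct_adj (u @ [a]) \<Longrightarrow> Tw u * Tw [a] = Tw (u @ [a])"
  by (rule Tw_append)

lemma Tw_left_cancel:
  assumes "distinct_adj (a # u)"
  shows "Tw [a] * Tw (a # u) = (of_nat q - 1) *\<^sub>C Tw (a # u) + of_nat q *\<^sub>C Tw u"
  unfolding Tw_left[OF assms, symmetric] mult.assoc[symmetric] Tw_quadratic
  by (simp add: distrib_right mult_scaleC_left)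

lemma Tw_right_cancel:
  assumes "distinct_adj (u @ [a])"
  shows "Tw (u @ [a]) * Tw [a] = (of_nat q - 1) *\<^sub>C Tw (u @ [a]) + of_nat q *\<^sub>C Tw u"
  unfolding Tw_right[OF assms, symmetric] mult.assoc Tw_quadratic
  by (simp add: distrib_left mult_scaleC_right)

text \<open>A linear map on the algebra is determined by its values on the basis.\<close>

lemma clinear_eqI:
  assumes "clinear f" "clinear g" "\<And>u. distinct_adj u \<Longrightarrow> f (Tw u) = g (Tw u)"
  shows "f x = g x"
proof (rule complex_vector.linear_eq_on[OF assms(1,2), of x "range T"])
  show "x \<in> complex_vector.span (range T)" by (simp add: span_T)
  fix b assume "b \<in> range T"
  then obtain w where "b = T w" by blast
  then show "f b = g b" using assms(3)[OF distinct_adj_nf[of w]] by (simp add: word_nf)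
qed

text \<open>The operator \<^const>\<open>one_Gc\<close> comes from the following trace-like map. It uses that the class of
  \<open>T\<^sub>w\<close>, for \<open>w\<close> of length \<open>2 * k + 1\<close> with middle letter \<open>c\<close>, is \<open>q ^ k\<close> times the class of
  \<open>T\<^sub>c\<close> up to classes of basis elements of positive even length.\<close>

definition compact_part :: "gen list \<Rightarrow> 'a HH0" where
  "compact_part u =
     (if odd (length u)
      then (of_nat q ^ (length u div 2)) *\<^sub>C HH0_class (Tw [u ! (length u div 2)])
      else if u = [] then HH0_class 1 else 0)"

definition compact_map :: "'a \<Rightarrow> 'a HH0" where
  "compact_map = complex_vector.construct (range T) (\<lambda>b. compact_part (nf (inv T b)))"

lemma clinear_compact_map: "clinear compact_map"
  unfolding compact_map_def by (rule complex_vector.linear_construct[OF independent_T])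

lemma compact_map_Tw: "distinct_adj u \<Longrightarrow> compact_map (Tw u) = compact_part u"
  unfolding compact_map_def
  by (subst complex_vector.construct_basis[OF independent_T])
    (auto simp: inj_T nf_word red_distinct_adj)

lemmas compact_map_simps =
  clinear_compact_map[unfolded clinear_iff, THEN conjunct1, rule_format]
  clinear_compact_map[unfolded clinear_iff, THEN conjunct2, rule_format]

lemma compact_map_trace_Tw:
  assumes u: "distinct_adj u"
  shows "compact_map (Tw [a] * Tw u) = compact_map (Tw u * Tw [a])"
proof (cases "u = []")
  case True
  then show ?thesis by (simp add: Tw_Nil)
next
  case False
  define k where "k = length u div 2"
  show ?thesis
  proof (cases "even (length u)")
    case True
    then have neq: "hd u \<noteq> last u" and k: "length u = 2 * k"
      using even_length_iff_hd_last[OF u False] by (auto simp: k_def)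
    then have "k > 0" using False by (cases k) auto
    show ?thesis
    proof (cases "hd u = a")
      case True
      then obtain w where w: "u = a # w" using False by (cases u) auto
      have d: "distinct_adj (u @ [a])"
        using u neq True by (auto simp: distinct_adj_append_iff)
      have "compact_map (Tw [a] * Tw u) = of_nat q *\<^sub>C compact_part w"
        using u k \<open>k > 0\<close> unfolding w
        by (subst Tw_left_cancel) (auto simp: compact_map_simps compact_map_Tw distinct_adj_ConsD compact_part_def)
      also have "\<dots> = compact_part (u @ [a])"
        using k \<open>k > 0\<close> by (cases k) (auto simp: w compact_part_def scaleC_scaleC nth_append)
      also have "\<dots> = compact_map (Tw u * Tw [a])"
        using d by (simp add: Tw_right compact_map_Tw)
      finally show ?thesis .
    next
      case hd: False
      then have last: "last u = a" using neq gen_neq_imp_eq by metis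
      then obtain w where w: "u = w @ [a]" using False by (metis append_butlast_last_id)
      have d: "distinct_adj (a # u)"
        using u hd False by (cases u) auto
      have dw: "distinct_adj w" using u w by (auto simp: distinct_adj_append_iff)
      have "compact_map (Tw u * Tw [a]) = of_nat q *\<^sub>C compact_part w"
        using u k \<open>k > 0\<close> dw unfolding w
        by (subst Tw_right_cancel) (auto simp: compact_map_simps compact_map_Tw compact_part_def)
      also have "\<dots> = compact_part (a # u)"
        using k \<open>k > 0\<close> by (cases k) (auto simp: w compact_part_def scaleC_scaleC nth_append nth_Cons')
      also have "\<dots> = compact_map (Tw [a] * Tw u)"
        using d by (simp add: Tw_left compact_map_Tw)
      finally show ?thesis by simp
    qed
  next
    case odd: False
    then have eq: "hd u = last u"
      using even_length_iff_hd_last[OF u False] by auto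
    show ?thesis
    proof (cases "hd u = a")
      case True
      then obtain w where w: "u = a # w" using False by (cases u) auto
      obtain w' where w': "u = w' @ [a]" using False eq True by (metis append_butlast_last_id)
      have dw: "distinct_adj w"
        using u unfolding w by (rule distinct_adj_ConsD)
      have dw': "distinct_adj w'"
        using u unfolding w' by (simp add: distinct_adj_append_iff)
      have "Tw [a] * Tw u = (of_nat q - 1) *\<^sub>C Tw u + of_nat q *\<^sub>C Tw w"
        using Tw_left_cancel[of a w] u w by simp
      moreover have "Tw u * Tw [a] = (of_nat q - 1) *\<^sub>C Tw u + of_nat q *\<^sub>C Tw w'"
        using Tw_right_cancel[of w' a] u w' by simp
      moreover have "compact_part w = compact_part w'"
      proof -
        have l: "length w = length w'" using w w' by (metis length_append_singleton length_Cons nat.inject)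
        have "even (length w)" using odd w by simp
        then show ?thesis using l by (auto simp: compact_part_def)
      qed
      ultimately show ?thesis
        using dw dw' u by (simp add: compact_map_simps compact_map_Tw)
    next
      case hd: False
      have d: "distinct_adj (a # u)"
        using u hd False by (cases u) auto
      have d': "distinct_adj (u @ [a])"
        using u hd eq False by (simp add: distinct_adj_append_iff)
      have "compact_part (a # u) = compact_part (u @ [a])"
        using odd by (simp add: compact_part_def)
      then show ?thesis
        by (simp only: Tw_left[OF d] Tw_right[OF d'] compact_map_Tw[OF d] compact_map_Tw[OF d'])
    qed
  qed
qed

lemma clinear_mult_left: "clinear f \<Longrightarrow> clinear (\<lambda>y. f (x * y))" for f :: "'a \<Rightarrow> 'b::complex_vector"
  by (auto simp: clinear_iff distrib_left mult_scaleC_right)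

lemma clinear_mult_right: "clinear f \<Longrightarrow> clinear (\<lambda>y. f (y * x))" for f :: "'a \<Rightarrow> 'b::complex_vector"
  by (auto simp: clinear_iff distrib_right mult_scaleC_left)

lemma compact_map_trace: "compact_map (x * y) = compact_map (y * x)"
proof -
  have gen: "compact_map (Tw [a] * y) = compact_map (y * Tw [a])" for a y
    by (rule clinear_eqI[OF clinear_mult_left[OF clinear_compact_map]
          clinear_mult_right[OF clinear_compact_map] compact_map_trace_Tw])
  have "distinct_adj u \<Longrightarrow> compact_map (Tw u * y) = compact_map (y * Tw u)" for u y
  proof (induction u arbitrary: y)
    case (Cons a u)
    have "compact_map (Tw (a # u) * y) = compact_map (Tw [a] * (Tw u * y))"
      by (simp only: Tw_left[OF Cons.prems, symmetric] mult.assoc)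
    also have "\<dots> = compact_map (Tw u * (y * Tw [a]))"
      by (simp add: gen mult.assoc)
    also have "\<dots> = compact_map (y * (Tw [a] * Tw u))"
      using Cons.IH[of "y * Tw [a]"] Cons.prems by (metis distinct_adj_ConsD mult.assoc)
    also have "\<dots> = compact_map (y * Tw (a # u))"
      using Cons.prems by (simp add: Tw_left)
    finally show ?case .
  qed (simp add: Tw_Nil)
  then show ?thesis
    by (rule clinear_eqI[OF clinear_mult_right[OF clinear_compact_map]
          clinear_mult_left[OF clinear_compact_map]])
qed

lemma compact_map_commutator: "z \<in> commutator_space \<Longrightarrow> compact_map z = 0"
  unfolding commutator_space_def
proof (rule complex_vector.linear_eq_0_on_span[OF clinear_compact_map])
  fix z :: 'a
  assume "z \<in> {x * y - y * x |x y. True}"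
  then show "compact_map z = 0"
    using compact_map_trace complex_vector.linear_diff[OF clinear_compact_map] by auto
qed

lemma HH0_class_odd:
  assumes "distinct_adj (a # w @ [a])"
  shows "HH0_class (Tw (a # w @ [a])) =
    (of_nat q - 1) *\<^sub>C HH0_class (Tw (w @ [a])) + of_nat q *\<^sub>C HH0_class (Tw w)"
proof -
  have d: "distinct_adj (w @ [a])" using assms by (auto dest: distinct_adj_ConsD)
  have "HH0_class (Tw (a # w @ [a])) = HH0_class (Tw (w @ [a]) * Tw [a])"
    using assms by (simp add: HH0_class_commute[of _ "Tw [a]"] Tw_left)
  then show ?thesis
    by (simp add: Tw_right_cancel[OF d] HH0_class_add HH0_class_scaleC)
qed

lemma HH0_class_rotate:
  assumes "distinct_adj (a # w)" "distinct_adj (w @ [a])"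
  shows "HH0_class (Tw (a # w)) = HH0_class (Tw (w @ [a]))"
  using HH0_class_commute[of "Tw [a]" "Tw w"] assms by (simp add: Tw_left Tw_right)

lemma HH0_clinear_eqI:
  fixes f g :: "'a HH0 \<Rightarrow> 'b::complex_vector"
  assumes f: "clinear f" and g: "clinear g"
    and eq: "f (HH0_class (T gs)) = g (HH0_class (T gs))"
      "f (HH0_class (T gt)) = g (HH0_class (T gt))"
      "\<And>n. f (HH0_class (T ((gs * gt) ^ n))) = g (HH0_class (T ((gs * gt) ^ n)))"
  shows "f = g"
proof -
  have Tw: "distinct_adj u \<Longrightarrow> f (HH0_class (Tw u)) = g (HH0_class (Tw u))" for u
  proof (induction u rule: length_induct)
    case (1 u)
    consider "u = []" | a where "u = [a]" | a w b where "u = a # w @ [b]"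
      by (metis append_butlast_last_id list.exhaust)
    then show ?case
    proof cases
      case 1
      then show ?thesis using eq(3)[of 0] by (simp add: word_Nil)
    next
      case (2 a)
      then show ?thesis using eq(1,2) by (cases a) (simp_all add: gs_def gt_def)
    next
      case (3 a w b)
      show ?thesis
      proof (cases "a = b")
        case True
        have "distinct_adj (w @ [b])" "distinct_adj w"
          using 1(2) 3 by (auto simp: distinct_adj_append_iff dest: distinct_adj_ConsD)
        then have "f (HH0_class (Tw (w @ [b]))) = g (HH0_class (Tw (w @ [b])))"
          "f (HH0_class (Tw w)) = g (HH0_class (Tw w))"
          using 1(1) 3 by auto
        then show ?thesis
          using f g 1(2) 3 True by (simp add: HH0_class_odd clinear_iff)
      next
        case False
        have even: "f (HH0_class (Tw x)) = g (HH0_class (Tw x))"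
          if "distinct_adj x" "even (length x)" "x \<noteq> []" "hd x = Gs" for x
          using eq(3) by (simp add: word_even[OF that])
        have ev: "even (length u)"
          using even_length_iff_hd_last[of u] 1(2) 3 False by simp
        show ?thesis
        proof (cases "a = Gs")
          case True
          then show ?thesis using even[of u] ev 1(2) 3 by simp
        next
          case a: False
          then have at: "a = Gt" "b = Gs" using False gen.exhaust by metis+
          have d: "distinct_adj ((w @ [b]) @ [a])"
            using 1(2) 3 False by (subst distinct_adj_append_iff) (auto dest: distinct_adj_ConsD)
          have "hd (w @ [b]) \<noteq> a" using 1(2) 3 by (cases w) auto
          then have "hd (w @ [b]) = Gs" using at gen.exhaust by metis
          then have "hd ((w @ [b]) @ [a]) = Gs" by (cases w) auto
          then show ?thesis
            using even[OF d] HH0_class_rotate[of a "w @ [b]"] d ev 1(2) 3 by simp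
        qed
      qed
    qed
  qed
  have "f (HH0_class x) = g (HH0_class x)" for x
    by (rule clinear_eqI[of "\<lambda>x. f (HH0_class x)"])
      (use f g Tw in \<open>auto simp: clinear_iff HH0_class_add HH0_class_scaleC\<close>)
  then show ?thesis by (metis HH0_class_surj ext)
qed

theorem one_Gc_exists_unique:
  "\<exists>!f. clinear f \<and>
     f (HH0_class (T gs)) = HH0_class (T gs) \<and>
     f (HH0_class (T gt)) = HH0_class (T gt) \<and>
     f (HH0_class (T 1)) = HH0_class (T 1) \<and>
     (\<forall>n\<ge>1. f (HH0_class (T ((gs * gt) ^ n))) = 0)" (is "\<exists>!f. ?P f")
proof (rule ex_ex1I)
  define f where "f h = compact_map (SOME x. HH0_class x = h)" for h
  have f: "f (HH0_class x) = compact_map x" for x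
  proof -
    define y where "y = (SOME y. HH0_class y = HH0_class x)"
    have "HH0_class y = HH0_class x" 
      unfolding y_def by (rule someI[of "\<lambda>y. HH0_class y = HH0_class x" x]) simp
    then have "compact_map (y - x) = 0"
      by (intro compact_map_commutator) (simp add: HH0_class_eq_iff)
    then show ?thesis
      using complex_vector.linear_diff[OF clinear_compact_map] by (simp add: f_def y_def)
  qed
  have lin: "clinear f"
    unfolding clinear_iff
  proof (intro conjI allI)
    fix h h' :: "'a HH0" and a
    obtain x y where [simp]: "h = HH0_class x" "h' = HH0_class y"
      using HH0_class_surj by metis
    show "f (h + h') = f h + f h'" "f (a *\<^sub>C h) = a *\<^sub>C f h"
      by (simp_all add: f compact_map_simps flip: HH0_class_add HH0_class_scaleC)
  qed
  have "f (HH0_class (T ((gs * gt) ^ n))) = 0" if "n \<ge> 1" for n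
  proof -
    obtain u where u: "distinct_adj u" "length u = 2 * n" "n > 0 \<longrightarrow> hd u = Gs"
      using distinct_adj_alt_exists[of n] by blast
    have "even (length u)" "length u div 2 = n" "u \<noteq> []" "hd u = Gs"
      using u that by auto
    with word_even[OF u(1)] have "T ((gs * gt) ^ n) = Tw u"
      by simp
    then show ?thesis
      using \<open>even (length u)\<close> \<open>u \<noteq> []\<close> by (simp add: f compact_map_Tw[OF u(1)] compact_part_def)
  qed
  moreover have "f (HH0_class (T 1)) = HH0_class (T 1)"
    using compact_map_Tw[of "[]"] by (simp add: f word_Nil compact_part_def T_one)
  moreover have "f (HH0_class (Tw [a])) = HH0_class (Tw [a])" for a
    using compact_map_Tw[of "[a]"] by (simp add: f compact_part_def scaleC_one)
  ultimately show "\<exists>f. ?P f"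
    using lin by (intro exI[of _ f]) (simp add: gs_def gt_def)
next
  fix f g
  assume f: "?P f" and g: "?P g"
  show "f = g"
  proof (rule HH0_clinear_eqI)
    show "f (HH0_class (T ((gs * gt) ^ n))) = g (HH0_class (T ((gs * gt) ^ n)))" for n
      using f g by (cases "n = 0") (auto simp: Suc_le_eq)
  qed (use f g in auto)
qed

lemma ring_inverse_eq: "is_ring_inverse x y \<Longrightarrow> ring_inverse x = (y :: 'a)"
  unfolding ring_inverse_def is_ring_inverse_def
proof (rule the_equality)
  fix z assume "x * y = 1 \<and> y * x = 1" and z: "x * z = 1 \<and> z * x = 1"
  then have "y * x * z = z" by simp
  then show "z = y" using z by (simp add: mult.assoc)
qed

lemma Tw_single_inverse:
  assumes "q > 0"
  shows "is_ring_inverse (Tw [a]) (inverse (of_nat q) *\<^sub>C (Tw [a] - (of_nat q - 1) *\<^sub>C 1))"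
proof -
  have "Tw [a] * Tw [a] - (of_nat q - 1) *\<^sub>C Tw [a] = of_nat q *\<^sub>C 1"
    by (simp add: Tw_quadratic)
  then show ?thesis
    using assms by (simp add: is_ring_inverse_def mult_scaleC_left mult_scaleC_right
        left_diff_distrib right_diff_distrib scaleC_scaleC scaleC_one)
qed

lemma T_ts_inverse: "q > 0 \<Longrightarrow> is_ring_inverse (T (gt * gs)) (ring_inverse (T (gt * gs)))"
proof -
  assume "q > 0"
  then obtain x y where x: "is_ring_inverse (T gt) x" and y: "is_ring_inverse (T gs) y"
    using Tw_single_inverse unfolding gs_def gt_def by blast
  have "T (gt * gs) = T gt * T gs"
    using Tw_append[of "[Gt]" "[Gs]"] by (simp add: gs_def gt_def flip: word_append)
  moreover have "is_ring_inverse (T gt * T gs) (y * x)"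
  proof -
    have "T gt * T gs * (y * x) = T gt * (T gs * y) * x" "y * x * (T gt * T gs) = y * (x * T gt) * T gs"
      by (simp_all only: mult.assoc)
    then show ?thesis
      using x y by (simp add: is_ring_inverse_def)
  qed
  ultimately show ?thesis by (simp add: ring_inverse_eq)
qed

end

context
  fixes U V :: "'a::complex_algebra_1"
  assumes UV: "U * V = 1" and VU: "V * U = 1"
begin

definition int_pow :: "int \<Rightarrow> 'a" where
  "int_pow n = (if n \<ge> 0 then U ^ nat n else V ^ nat (- n))"

lemma int_pow_0: "int_pow 0 = 1"
  by (simp add: int_pow_def)

lemma int_pow_plus_1: "int_pow (n + 1) = int_pow n * U"
proof (cases "n \<ge> 0")
  case True
  then show ?thesis by (simp add: int_pow_def nat_add_distrib power_commutes)
next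
  case False
  then obtain k where k: "n = - int (Suc k)"
    by (cases n) auto
  have "nat (- n) = Suc k" using k by simp
  then have "int_pow n * U = V ^ k * (V * U)"
    using k by (simp add: int_pow_def nat_add_distrib mult.assoc power_Suc2 del: power_Suc)
  moreover have "int_pow (n + 1) = V ^ k"
    using k by (auto simp: int_pow_def)
  ultimately show ?thesis by (simp add: VU)
qed

lemma int_pow_minus_1: "int_pow (n - 1) = int_pow n * V"
proof -
  have "int_pow n * V = int_pow (n - 1) * U * V"
    using int_pow_plus_1[of "n - 1"] by simp
  then show ?thesis by (simp add: mult.assoc UV)
qed

lemma int_pow_add: "int_pow (m + n) = int_pow m * int_pow n"
proof (induction n rule: int_induct[where k = 0])
  case base
  then show ?case by (simp add: int_pow_0)
next
  case (step1 n)
  have "int_pow (m + (n + 1)) = int_pow (m + n + 1)" by (simp add: add.assoc)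
  then show ?case using step1 by (simp only: int_pow_plus_1 mult.assoc)
next
  case (step2 n)
  have "int_pow (m + (n - 1)) = int_pow (m + n - 1)" by (simp add: algebra_simps)
  then show ?case using step2 by (simp only: int_pow_minus_1 mult.assoc)
qed

definition laurent_eval :: "laurent \<Rightarrow> 'a" where
  "laurent_eval f = (\<Sum>k\<in>Poly_Mapping.keys f. Poly_Mapping.lookup f k *\<^sub>C int_pow k)"

lemma laurent_eval_superset:
  assumes "finite S" "Poly_Mapping.keys f \<subseteq> S"
  shows "laurent_eval f = (\<Sum>k\<in>S. Poly_Mapping.lookup f k *\<^sub>C int_pow k)"
  unfolding laurent_eval_def
  by (rule sum.mono_neutral_left) (use assms in \<open>auto simp: in_keys_iff\<close>)

lemma laurent_eval_add: "laurent_eval (f + g) = laurent_eval f + laurent_eval g"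
proof -
  let ?S = "Poly_Mapping.keys f \<union> Poly_Mapping.keys g"
  have "Poly_Mapping.keys (f + g) \<subseteq> ?S" by (rule keys_add)
  then show ?thesis
    by (simp add: laurent_eval_superset[of ?S] lookup_add scaleC_add_left sum.distrib)
qed

lemma laurent_eval_single: "laurent_eval (Poly_Mapping.single k c) = c *\<^sub>C int_pow k"
  by (subst laurent_eval_superset[of "{k}"]) auto

lemma algebra_hom_laurent_eval: "algebra_hom laurent_eval"
proof -
  have "laurent_eval (a *\<^sub>C f) = a *\<^sub>C laurent_eval f" for a f
  proof (induction f rule: poly_mapping_additive_induct)
    case zero
    then show ?case by (simp add: laurent_eval_def)
  next
    case (plus f k c)
    then show ?case
      by (simp add: laurent_eval_add scaleC_add_right scaleC_single laurent_eval_single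
        scaleC_scaleC scaleC_complex_def)
  qed
  moreover have "laurent_eval (f * g) = laurent_eval f * laurent_eval g" for f g
  proof (induction f rule: poly_mapping_additive_induct)
    case zero
    then show ?case by (simp add: laurent_eval_def)
  next
    case (plus f k c)
    have "laurent_eval (Poly_Mapping.single k c * g) = c *\<^sub>C int_pow k * laurent_eval g"
    proof (induction g rule: poly_mapping_additive_induct)
      case zero
      then show ?case by (simp add: laurent_eval_def)
    next
      case (plus g l d)
      then show ?case
        by (simp add: distrib_left laurent_eval_add mult_single laurent_eval_single int_pow_add
            mult_scaleC_left mult_scaleC_right scaleC_scaleC)
    qed
    then show ?case
      using plus by (simp add: distrib_right laurent_eval_add laurent_eval_single)
  qed
  moreover have "laurent_eval 1 = 1"
    using laurent_eval_single[of 0 1] by (simp add: int_pow_0 scaleC_one)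
  ultimately show ?thesis
    by (simp add: algebra_hom_def clinear_iff laurent_eval_add)
qed

lemma algebra_hom_laurent_unique:
  assumes \<phi>: "algebra_hom \<phi>" "\<phi> (lam_pow 1) = U"
  shows "\<phi> = laurent_eval"
proof -
  have hom: "\<phi> (f + g) = \<phi> f + \<phi> g" "\<phi> (a *\<^sub>C f) = a *\<^sub>C \<phi> f" "\<phi> (f * g) = \<phi> f * \<phi> g" "\<phi> 1 = 1" for f g a
    using \<phi>(1) by (simp_all add: algebra_hom_def clinear_iff)
  have mult: "lam_pow (m + n) = lam_pow m * lam_pow n" for m n
    by (simp add: lam_pow_def mult_single)
  have one: "lam_pow 0 = 1" by (simp add: lam_pow_def)
  have inv: "\<phi> (lam_pow (- 1)) = V"
  proof -
    have "U * \<phi> (lam_pow (- 1)) = 1"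
      using hom(3)[of "lam_pow 1" "lam_pow (- 1)"] hom(4) mult[of 1 "- 1"] one \<phi>(2) by simp
    then have "V * U * \<phi> (lam_pow (- 1)) = V" by (simp add: mult.assoc)
    then show ?thesis by (simp add: VU)
  qed
  have pow: "\<phi> (lam_pow n) = int_pow n" for n
  proof (induction n rule: int_induct[where k = 0])
    case base
    then show ?case using hom by (simp add: int_pow_0 one)
  next
    case (step1 n)
    then show ?case using hom \<phi>(2) by (simp add: int_pow_plus_1 mult)
  next
    case (step2 n)
    then show ?case using hom inv mult[of n "- 1"] by (simp add: int_pow_minus_1)
  qed
  have "\<phi> (Poly_Mapping.single k c) = laurent_eval (Poly_Mapping.single k c)" for k c
  proof -
    have "Poly_Mapping.single k c = c *\<^sub>C lam_pow k"
      by (simp add: lam_pow_def scaleC_single scaleC_complex_def)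
    then have "\<phi> (Poly_Mapping.single k c) = c *\<^sub>C int_pow k"
      by (simp only: hom(2) pow)
    then show ?thesis by (simp only: laurent_eval_single)
  qed
  moreover have "\<phi> 0 = 0"
    using hom(1)[of 0 0] by simp
  ultimately have "\<phi> f = laurent_eval f" for f
  proof (induction f rule: poly_mapping_additive_induct)
    case zero
    then show ?case by (simp add: laurent_eval_def)
  next
    case (plus f k c)
    then show ?case by (simp only: hom(1) laurent_eval_add)
  qed
  then show ?thesis by blast
qed

end

theorem (in iwahori_hecke) ind_hom_exists_unique:
  assumes "q > 0"
  shows "\<exists>!\<phi>. algebra_hom \<phi> \<and> \<phi> (lam_pow 1) = of_nat q *\<^sub>C ring_inverse (T (gt * gs))"
proof -
  let ?U = "of_nat q *\<^sub>C ring_inverse (T (gt * gs))" and ?V = "inverse (of_nat q) *\<^sub>C T (gt * gs)"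
  have UV: "?U * ?V = 1" "?V * ?U = 1"
    using T_ts_inverse[OF assms] assms unfolding is_ring_inverse_def
    by (simp_all add: mult_scaleC_left mult_scaleC_right scaleC_scaleC scaleC_one)
  have "laurent_eval ?U ?V (lam_pow 1) = ?U"
    using laurent_eval_single[OF UV, of 1 1] int_pow_plus_1[OF UV, of 0] int_pow_0[OF UV]
    by (simp add: lam_pow_def scaleC_one)
  then show ?thesis
    using algebra_hom_laurent_eval[OF UV] algebra_hom_laurent_unique[OF UV] by blast
qed

end

theory Submission
  imports Defs
begin

text \<open>
  Write \<open>X = (T\<^sub>s - (q - 1)) (T\<^sub>t - (q - 1))\<close> and \<open>Y = T\<^sub>t T\<^sub>s\<close>. Since \<open>T\<^sub>a\<close> has inverse
  \<open>(T\<^sub>a - (q - 1)) / q\<close>, we have \<open>X Y = Y X = q\<^sup>2\<close>, so that induction sends \<open>\<lambda>\<^sup>n\<close> to \<open>X\<^sup>n / q\<^sup>n\<close> and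
  \<open>\<lambda>\<^bsup>-n\<^esup>\<close> to \<open>Y\<^sup>n / q\<^sup>n\<close>. Let \<open>\<tau>\<close> be the class map to \<open>HH\<^sub>0\<close> followed by the operator
  restricting to the compact elements; it is a linear trace. It kills \<open>(T\<^sub>s T\<^sub>t)\<^sup>n\<close> for \<open>n \<ge> 1\<close> by definition and
  \<open>Y\<^sup>n\<close> by rotation, which settles the negative powers of \<open>\<lambda>\<close>, and it fixes the class of \<open>1\<close>,
  which settles \<open>\<lambda>\<^sup>0\<close>; everything else is the computation of \<open>\<tau>(X\<^sup>n)\<close>.

  The key is the element \<open>B = T\<^sub>s + T\<^sub>t - (q - 1)\<close>, for which \<open>X + Y = B\<^sup>2 - 2 q\<close>. Thus \<open>X\<close> and \<open>Y\<close>
  behave like the squares of the two roots of \<open>x\<^sup>2 - B x + q\<close>, and \<open>X\<^sup>n + Y\<^sup>n = V\<^bsub>2n\<^esub>\<close> for the Lucas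
  sequence \<open>V\<^sub>0 = 2\<close>, \<open>V\<^sub>1 = B\<close>, \<open>V\<^bsub>k+2\<^esub> = B V\<^bsub>k+1\<^esub> - q V\<^sub>k\<close> (\<open>lucas_even_bar\<close>). Hence
  \<open>\<tau>(X\<^sup>n) = \<tau>(V\<^bsub>2n\<^esub>)\<close>.

  Let \<open>S\<^sub>k\<close> be the sum of the two alternating products of length \<open>k\<close> in \<open>T\<^sub>s\<close> and \<open>T\<^sub>t\<close>. The sequence
  \<open>S\<close> satisfies the same recurrence as \<open>V\<close>, starting from \<open>S\<^sub>0 = 2\<close> and \<open>S\<^sub>1 = B + (q - 1)\<close>, and comparing
  initial values gives \<open>V\<^bsub>k+2\<^esub> + (q - 1) V\<^bsub>k+1\<^esub> - q V\<^sub>k = S\<^bsub>k+2\<^esub> - q S\<^sub>k\<close> (\<open>lucas_alt_prod\<close>). For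
  \<open>k \<ge> 1\<close> the trace kills the right-hand side: both terms have trace zero if \<open>k\<close> is even, and if \<open>k\<close> is
  odd then the two end letters agree, so a rotation brings them together and the quadratic
  relation contracts them
  (\<open>compact_trace_alt_sum_rec\<close>). So \<open>\<tau>(V\<^sub>k)\<close> obeys a linear recurrence with characteristic roots
  \<open>1\<close> and \<open>-q\<close>, and at \<open>k = 0\<close> the equality \<open>V\<^sub>0 = S\<^sub>0\<close> gives
  \<open>\<tau>(V\<^sub>2) = - (q - 1) \<tau>(B)\<close>. The solution is the geometric sum \<open>1 - q + \<dots> + (-q)\<^bsup>k-1\<^esup>\<close> times the class of \<open>B\<close>.
  At \<open>k = 2 n\<close> that sum is \<open>- R / (q - 1)\<close>.
\<close>

section \<open>Alternating products and Lucas sequences\<close>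

fun alt_prod :: "'a::monoid_mult \<Rightarrow> 'a \<Rightarrow> nat \<Rightarrow> 'a" where
  "alt_prod x y 0 = 1"
| "alt_prod x y (Suc k) = x * alt_prod y x k"

text \<open>The Lucas sequence \<open>V\<^sub>k(P, Q)\<close>: in a commutative ring, \<open>V\<^sub>k = \<alpha>\<^sup>k + \<beta>\<^sup>k\<close> for the roots
  \<open>\<alpha>\<close>, \<open>\<beta>\<close> of \<open>x\<^sup>2 - P x + Q\<close>.\<close>

fun lucas :: "'a::ring_1 \<Rightarrow> 'a \<Rightarrow> nat \<Rightarrow> 'a" where
  "lucas P Q 0 = 2"
| "lucas P Q (Suc 0) = P"
| "lucas P Q (Suc (Suc k)) = P * lucas P Q (Suc k) - Q * lucas P Q k"

lemma alt_prod_even: "alt_prod x y (2 * n) = (x * y) ^ n"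
  by (induction n) (simp_all add: mult.assoc)

lemma power_mult_shift: "x * (y * x) ^ n = (x * y) ^ n * x" for x y :: "'a::monoid_mult"
  by (induction n) (simp_all add: mult.assoc)

lemma alt_prod_odd: "alt_prod x y (Suc (2 * n)) = (x * y) ^ n * x"
  by (simp add: alt_prod_even power_mult_shift)

text \<open>Here \<open>X\<close> and \<open>Y\<close> play the part of \<open>\<alpha>\<^sup>2\<close> and \<open>\<beta>\<^sup>2\<close>: the sequence
  \<open>V\<^bsub>2n\<^esub>\<close> and the power sums of \<open>X\<close>, \<open>Y\<close> satisfy the same recurrence, with coefficients
  \<open>P\<^sup>2 - 2 Q = X + Y\<close> and \<open>- Q\<^sup>2 = - X Y\<close>.\<close>

lemma lucas_even:
  fixes P Q X Y :: "'a::ring_1"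
  assumes central: "\<And>x. x * Q = Q * x"
    and sum: "X + Y = P * P - 2 * Q" and XY: "X * Y = Q * Q" and YX: "Y * X = Q * Q"
  shows "lucas P Q (2 * n) = X ^ n + Y ^ n"
proof (induction n rule: induct_nat_012)
  case 1
  show ?case using sum central[of 2] by (simp add: numeral_2_eq_2)
next
  case (ge2 n)
  define V where "V = lucas P Q"
  have V: "V (Suc (Suc k)) = P * V (Suc k) - Q * V k" for k
    by (simp add: V_def)
  have "P * V (Suc (2 * n)) = V (2 * Suc n) + Q * V (2 * n)"
    by (simp add: V)
  moreover have "V (2 * Suc (Suc n)) = P * (P * V (2 * Suc n) - Q * V (Suc (2 * n))) - Q * V (2 * Suc n)"
    by (simp add: V)
  moreover have "P * (Q * x) = Q * (P * x)" for x
    by (metis central mult.assoc)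
  ultimately have "V (2 * Suc (Suc n)) = (P * P - 2 * Q) * V (2 * Suc n) - Q * Q * V (2 * n)"
    by (simp add: algebra_simps flip: mult_2)
  also have "\<dots> = (X + Y) * (X ^ Suc n + Y ^ Suc n) - (X * Y * Y ^ n + Y * X * X ^ n)"
    using ge2 by (simp add: V_def sum XY YX distrib_left)
  also have "\<dots> = X ^ Suc (Suc n) + Y ^ Suc (Suc n)"
    by (simp add: algebra_simps)
  finally show ?case by (simp add: V_def)
qed simp

context
  fixes s t Q :: "'a::ring_1"
  assumes central: "\<And>x. x * Q = Q * x"
    and quadratic_s: "s * s = (Q - 1) * s + Q"
    and quadratic_t: "t * t = (Q - 1) * t + Q"
begin

lemma central_left: "x * (Q * y) = Q * (x * y)"
  by (metis central mult.assoc)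

lemmas commutes = central[of s] central[of t] central_left[of s] central_left[of t]

text \<open>Reassociated forms of the quadratic relations, which rewrite inside right-nested products.\<close>

lemma quadratic_left: "s * (s * x) = (Q - 1) * (s * x) + Q * x" "t * (t * x) = (Q - 1) * (t * x) + Q * x"
  by (simp_all add: quadratic_s quadratic_t distrib_right mult.assoc
      flip: mult.assoc[of s s] mult.assoc[of t t])

abbreviation (input) "B \<equiv> s + t - (Q - 1)"

text \<open>Multiplying an alternating product by \<open>B\<close> either prolongs it or, through the quadratic
  relation, shortens it; the term \<open>- (Q - 1)\<close> in \<open>B\<close> cancels the part of the quadratic relation
  that keeps the length.\<close>

lemma alt_prod_sum_rec:
  "alt_prod s t (Suc (Suc k)) + alt_prod t s (Suc (Suc k)) =
    B * (alt_prod s t (Suc k) + alt_prod t s (Suc k)) - Q * (alt_prod s t k + alt_prod t s k)"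
  by (simp add: algebra_simps quadratic_left commutes)

text \<open>Both sides solve the recurrence \<open>D\<^bsub>k+2\<^esub> = B D\<^bsub>k+1\<^esub> - Q D\<^sub>k\<close>, so it is enough to compare them
  for two consecutive values of \<open>k\<close>.\<close>

lemma lucas_alt_prod:
  "lucas B Q (Suc (Suc k)) + (Q - 1) * lucas B Q (Suc k) - Q * lucas B Q k =
   (alt_prod s t (Suc (Suc k)) + alt_prod t s (Suc (Suc k))) - Q * (alt_prod s t k + alt_prod t s k)"
proof (induction k rule: induct_nat_012)
  case 0
  show ?case by (simp add: algebra_simps quadratic_s quadratic_t commutes mult_2 mult_2_right)
next
  case 1
  show ?case
    by (simp add: algebra_simps quadratic_s quadratic_t commutes quadratic_left mult_2 mult_2_right)
next
  case (ge2 k)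
  define V where "V = lucas B Q"
  define W where "W k = alt_prod s t k + alt_prod t s k" for k
  define P where "P = B"
  have V: "V (Suc (Suc k)) = P * V (Suc k) - Q * V k" for k
    by (simp add: V_def P_def)
  have W: "W (Suc (Suc k)) = P * W (Suc k) - Q * W k" for k
    unfolding W_def P_def by (rule alt_prod_sum_rec)
  define D where "D k = V (Suc (Suc k)) + (Q - 1) * V (Suc k) - Q * V k - (W (Suc (Suc k)) - Q * W k)" for k
  have "D (Suc (Suc k)) = P * D (Suc k) - Q * D k"
    unfolding D_def V[of "Suc (Suc k)"] V[of "Suc k"] V[of k] W[of "Suc (Suc k)"]  W[of "Suc k"] W[of k]
    by (simp add: algebra_simps central_left[of P])
  moreover have "D k = 0" "D (Suc k) = 0"
    using ge2 by (simp_all add: D_def V_def W_def)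
  ultimately show ?case
    by (simp add: D_def V_def W_def)
qed

text \<open>Because \<open>(s - (Q - 1)) s = Q\<close>, and likewise for \<open>t\<close>.\<close>

lemma bar_mult:
  "(s - (Q - 1)) * (t - (Q - 1)) * (t * s) = Q * Q"
  "t * s * ((s - (Q - 1)) * (t - (Q - 1))) = Q * Q"
  by (simp_all add: algebra_simps quadratic_s quadratic_t commutes quadratic_left mult_2 mult_2_right)

lemma lucas_even_bar:
  "lucas B Q (2 * n) = ((s - (Q - 1)) * (t - (Q - 1))) ^ n + (t * s) ^ n"
proof (rule lucas_even[OF central _ bar_mult])
  show "(s - (Q - 1)) * (t - (Q - 1)) + t * s = B * B - 2 * Q"
    by (simp add: algebra_simps quadratic_s quadratic_t commutes mult_2 mult_2_right)
qed

end

section \<open>The trace on the Iwahori--Hecke algebra\<close>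

context iwahori_hecke
begin

definition compact_trace :: "'a \<Rightarrow> 'a HH0" where
  "compact_trace x = one_Gc T (HH0_class x)"

lemma one_Gc:
  "clinear (one_Gc T)"
  "one_Gc T (HH0_class (T gs)) = HH0_class (T gs)"
  "one_Gc T (HH0_class (T gt)) = HH0_class (T gt)"
  "one_Gc T (HH0_class (T 1)) = HH0_class (T 1)"
  "n \<ge> 1 \<Longrightarrow> one_Gc T (HH0_class (T ((gs * gt) ^ n))) = 0"
  using theI'[OF one_Gc_exists_unique, folded one_Gc_def] by blast+

lemma clinear_compact_trace: "clinear compact_trace"
  using one_Gc(1) by (simp add: clinear_iff compact_trace_def HH0_class_add HH0_class_scaleC)

lemmas compact_trace_linear =
  complex_vector.linear_add[OF clinear_compact_trace]
  complex_vector.linear_diff[OF clinear_compact_trace]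
  complex_vector.linear_scale[OF clinear_compact_trace]

lemma compact_trace_commute: "compact_trace (x * y) = compact_trace (y * x)"
  by (simp add: compact_trace_def HH0_class_commute)

lemma T_st_power: "T ((gs * gt) ^ n) = (T gs * T gt) ^ n"
proof -
  have "Tw u = (T gs * T gt) ^ (length u div 2)"
    if "distinct_adj u" "even (length u)" "u \<noteq> [] \<longrightarrow> hd u = Gs" for u
    using that
  proof (induction u rule: induct_list012)
    case (3 a b u)
    then have ab: "a = Gs" "b = Gt"
      using gen.exhaust[of b] by auto
    have "Tw u = (T gs * T gt) ^ (length u div 2)"
    proof (rule 3(1))
      show "u \<noteq> [] \<longrightarrow> hd u = Gs"
        using 3(3) ab gen.exhaust[of "hd u"] by (cases u) auto
    qed (use 3 in \<open>auto dest: distinct_adj_ConsD\<close>)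
    moreover have "Tw (a # b # u) = T gs * (T gt * Tw u)"
      using Tw_left[of a "b # u"] Tw_left[of b u] 3(3) ab
      by (simp add: gs_def gt_def)
    ultimately show ?case by (simp add: mult.assoc)
  qed (simp_all add: Tw_Nil)
  moreover obtain u where u: "distinct_adj u" "length u = 2 * n" "n > 0 \<longrightarrow> hd u = Gs"
    using distinct_adj_alt_exists[of n] by blast
  moreover have "word u = (gs * gt) ^ n"
    using word_even[of u] u by (cases "u = []") (auto simp: word_Nil)
  moreover have "u \<noteq> [] \<longrightarrow> hd u = Gs"
    using u by auto
  ultimately show ?thesis
    using u(2) by (metis dvd_triv_left nonzero_mult_div_cancel_left zero_neq_numeral)
qed

lemma compact_trace_st_power: "n \<ge> 1 \<Longrightarrow> compact_trace ((T gs * T gt) ^ n) = 0"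
  by (simp add: compact_trace_def one_Gc(5) flip: T_st_power)

text \<open>Moving the first letter to the end turns \<open>(T\<^sub>t T\<^sub>s)\<^sup>n\<close> into \<open>(T\<^sub>s T\<^sub>t)\<^sup>n\<close>.\<close>

lemma compact_trace_ts_power:
  assumes "n \<ge> 1"
  shows "compact_trace ((T gt * T gs) ^ n) = 0"
proof -
  obtain m where n: "n = Suc m" using assms by (cases n) auto
  have "(T gt * T gs) ^ n = T gt * (T gs * (T gt * T gs) ^ m)"
    by (simp add: n mult.assoc)
  also have "\<dots> = T gt * ((T gs * T gt) ^ m * T gs)"
    by (simp only: power_mult_shift)
  finally have "compact_trace ((T gt * T gs) ^ n) = compact_trace ((T gs * T gt) ^ m * T gs * T gt)"
    by (simp only: compact_trace_commute[of "T gt"])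
  also have "(T gs * T gt) ^ m * T gs * T gt = (T gs * T gt) ^ n"
    by (simp only: n power_Suc2 mult.assoc)
  finally show ?thesis using assms by (simp add: compact_trace_st_power)
qed

text \<open>This passes between the scalar \<open>q\<close> and the central ring element \<open>q\<close>; the identities of
  the previous section are about the latter.\<close>

lemma of_nat_mult: "of_nat q * x = of_nat q *\<^sub>C (x :: 'a)"
proof -
  have "of_nat n * x = of_nat n *\<^sub>C x" for n
    by (induction n) (simp_all add: distrib_right scaleC_add_left scaleC_one)
  then show ?thesis .
qed

lemma Hecke_quadratic:
  "T gs * T gs = (of_nat q - 1) * T gs + of_nat q"
  "T gt * T gt = (of_nat q - 1) * T gt + of_nat q"
  by (simp_all add: T_quadratic_s T_quadratic_t left_diff_distrib of_nat_mult
      complex_vector.scale_left_diff_distrib scaleC_one flip: of_nat_mult[of 1])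

lemma compact_trace_quadratic:
  assumes "x * x = (of_nat q - 1) * x + of_nat q"
  shows "compact_trace (x * y * x) =
    (of_nat q - 1) *\<^sub>C compact_trace (x * y) + of_nat q *\<^sub>C compact_trace y"
proof -
  have "compact_trace (x * y * x) = compact_trace (x * x * y)"
    using compact_trace_commute[of "x * y" x] by (simp add: mult.assoc)
  also have "x * x * y = (of_nat q - 1) *\<^sub>C (x * y) + of_nat q *\<^sub>C y"
    by (simp add: assms distrib_right left_diff_distrib of_nat_mult mult_scaleC_left scaleC_one
        complex_vector.scale_left_diff_distrib)
  finally show ?thesis by (simp only: compact_trace_linear)
qed

abbreviation (input) "alt_sum k \<equiv> alt_prod (T gs) (T gt) k + alt_prod (T gt) (T gs) k"

lemma compact_trace_alt_prod_even:
  assumes "even k" "k > 0"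
  shows "compact_trace (alt_prod (T gs) (T gt) k) = 0" "compact_trace (alt_prod (T gt) (T gs) k) = 0"
proof -
  obtain n where "k = 2 * n" "n \<ge> 1" using assms by (auto elim!: evenE)
  then show "compact_trace (alt_prod (T gs) (T gt) k) = 0" "compact_trace (alt_prod (T gt) (T gs) k) = 0"
    by (simp_all add: alt_prod_even compact_trace_st_power compact_trace_ts_power)
qed

text \<open>For odd \<open>k\<close>, an alternating product of length \<open>k + 2\<close> is \<open>x w x\<close> with \<open>w\<close> alternating of length
  \<open>k\<close>, and \<open>\<tau>(x w x) = (q - 1) \<tau>(x w) + q \<tau>(w)\<close>. The first term vanishes because \<open>x w\<close> has positive
  even length. The hypothesis \<open>k \<ge> 1\<close> excludes the
  empty product, whose trace is the class of \<open>1\<close>.\<close>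

lemma compact_trace_alt_sum_rec:
  assumes "k \<ge> 1"
  shows "compact_trace (alt_sum (Suc (Suc k))) = of_nat q *\<^sub>C compact_trace (alt_sum k)"
proof (cases "even k")
  case True
  then show ?thesis
    using assms by (simp add: compact_trace_linear compact_trace_alt_prod_even del: alt_prod.simps)
next
  case False
  then obtain n where k: "k = Suc (2 * n)" by (metis oddE Suc_eq_plus1)
  have conj: "alt_prod x y (Suc (Suc k)) = x * alt_prod y x k * x" for x y :: 'a
  proof -
    have "alt_prod x y (Suc (Suc k)) = x * y * ((x * y) ^ n * x)"
      using alt_prod_odd[of x y "Suc n"] by (simp add: k mult.assoc)
    also have "\<dots> = x * ((y * (x * y) ^ n) * x)"
      by (simp only: mult.assoc)
    also have "\<dots> = x * alt_prod y x k * x"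
      by (simp only: k alt_prod_odd power_mult_shift mult.assoc)
    finally show ?thesis .
  qed
  have step: "compact_trace (alt_prod x y (Suc (Suc k))) = of_nat q *\<^sub>C compact_trace (alt_prod y x k)"
    if "x * x = (of_nat q - 1) * x + of_nat q" "compact_trace (alt_prod x y (Suc k)) = 0" for x y
    unfolding conj using compact_trace_quadratic[OF that(1), of "alt_prod y x k"] that(2) by simp
  have "even (Suc k)" "Suc k > 0" using False by auto
  note even = compact_trace_alt_prod_even[OF this]
  show ?thesis
    using step[OF Hecke_quadratic(1) even(1)] step[OF Hecke_quadratic(2) even(2)]
    by (simp only: compact_trace_linear scaleC_add_right add.commute)
qed

text \<open>The name records that \<open>T\<^sub>s B = B T\<^sub>t\<close> and \<open>T\<^sub>t B = B T\<^sub>s\<close> for this element \<open>B\<close>: it intertwines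
  the two generators.\<close>

definition swap_elem :: 'a where
  "swap_elem = T gs + T gt - (of_nat q - 1)"

lemma compact_trace_swap_elem: "compact_trace swap_elem = HH0_class swap_elem"
proof -
  have "swap_elem = T gs + T gt - (of_nat q - 1) *\<^sub>C T 1"
    using of_nat_mult[of 1]
    by (simp add: swap_elem_def T_one complex_vector.scale_left_diff_distrib scaleC_one)
  then show ?thesis
    by (simp only: compact_trace_linear complex_vector.linear_add[OF clinear_HH0_class]
        complex_vector.linear_diff[OF clinear_HH0_class] complex_vector.linear_scale[OF clinear_HH0_class])
      (simp add: compact_trace_def one_Gc)
qed

lemma compact_trace_lucas:
  "compact_trace (lucas swap_elem (of_nat q) (Suc k)) = (\<Sum>j\<le>k. (- of_nat q) ^ j) *\<^sub>C HH0_class swap_elem"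
proof -
  define \<tau> where "\<tau> k = compact_trace (lucas swap_elem (of_nat q) k)" for k
  have rec: "\<tau> (Suc (Suc k)) = of_nat q *\<^sub>C \<tau> k - (of_nat q - 1) *\<^sub>C \<tau> (Suc k) +
     (compact_trace (alt_sum (Suc (Suc k))) - of_nat q *\<^sub>C compact_trace (alt_sum k))" for k
  proof -
    have "lucas swap_elem (of_nat q) (Suc (Suc k)) = of_nat q *\<^sub>C lucas swap_elem (of_nat q) k
      - (of_nat q - 1) *\<^sub>C lucas swap_elem (of_nat q) (Suc k)
      + (alt_sum (Suc (Suc k)) - of_nat q *\<^sub>C alt_sum k)"
      using lucas_alt_prod[OF mult_of_nat_commute[symmetric] Hecke_quadratic, of k]
      by (simp add: swap_elem_def left_diff_distrib of_nat_mult complex_vector.scale_left_diff_distrib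
          scaleC_one algebra_simps del: lucas.simps alt_prod.simps)
    then show ?thesis by (simp only: \<tau>_def compact_trace_linear)
  qed
  have one: "\<tau> (Suc 0) = HH0_class swap_elem"
    by (simp add: \<tau>_def compact_trace_swap_elem)
  have "\<tau> (Suc k) = (\<Sum>j\<le>k. (- of_nat q) ^ j) *\<^sub>C HH0_class swap_elem"
  proof (induction k rule: induct_nat_012)
    case 0
    show ?case by (simp add: one scaleC_one)
  next
    case 1
    \<comment> \<open>Both sequences start with \<open>2\<close>, so these two contributions to the recurrence cancel.\<close>
    have "alt_sum 0 = lucas swap_elem (of_nat q) 0" by simp
    moreover have "compact_trace (alt_sum (Suc (Suc 0))) = 0"
      by (simp add: compact_trace_linear compact_trace_alt_prod_even del: alt_prod.simps)
    ultimately have "\<tau> (Suc (Suc 0)) = - ((of_nat q - 1) *\<^sub>C \<tau> (Suc 0))"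
      using rec[of 0] by (simp only: \<tau>_def) simp
    then show ?case
      by (simp add: one complex_vector.scale_left_diff_distrib)
  next
    case (ge2 k)
    have "\<tau> (Suc (Suc (Suc k))) = of_nat q *\<^sub>C \<tau> (Suc k) - (of_nat q - 1) *\<^sub>C \<tau> (Suc (Suc k))"
      using rec[of "Suc k"] compact_trace_alt_sum_rec[of "Suc k"] by simp
    then show ?case
      by (simp add: ge2 scaleC_scaleC algebra_simps
          flip: complex_vector.scale_left_diff_distrib scaleC_add_left)
  qed
  then show ?thesis by (simp add: \<tau>_def)
qed


section \<open>The image of parabolic induction\<close>

text \<open>The element \<open>q\<^sup>2 T\<^sub>t\<^sub>s\<^sup>-\<^sup>1\<close>, where \<open>T\<^sub>t\<^sub>s\<^sup>-\<^sup>1\<close> is what the Kazhdan--Lusztig bar involution makes of \<open>T\<^sub>s\<^sub>t\<close>.\<close>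

definition bar_st :: 'a where
  "bar_st = (T gs - (of_nat q - 1)) * (T gt - (of_nat q - 1))"

lemma T_ts: "T (gt * gs) = T gt * T gs"
  using Tw_append[of "[Gt]" "[Gs]"] by (simp add: gs_def gt_def flip: word_append)

lemma bar_st_mult:
  "bar_st * (T gt * T gs) = of_nat q *\<^sub>C of_nat q *\<^sub>C 1"
  "T gt * T gs * bar_st = of_nat q *\<^sub>C of_nat q *\<^sub>C 1"
  using bar_mult[OF mult_of_nat_commute[symmetric] Hecke_quadratic]
  by (simp_all add: bar_st_def of_nat_mult flip: of_nat_mult[of 1])

lemma q_ring_inverse_T_ts:
  assumes "q > 0"
  shows "of_nat q *\<^sub>C ring_inverse (T (gt * gs)) = inverse (of_nat q) *\<^sub>C bar_st"
proof -
  have "inverse (of_nat q) * inverse (of_nat q) * (of_nat q * of_nat q) = (1 :: complex)"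
    using assms by (simp add: field_simps)
  then have "is_ring_inverse (T (gt * gs)) ((inverse (of_nat q) * inverse (of_nat q)) *\<^sub>C bar_st)"
    unfolding is_ring_inverse_def T_ts
    by (simp add: mult_scaleC_left mult_scaleC_right bar_st_mult scaleC_scaleC scaleC_one)
  then show ?thesis
    using assms by (simp add: ring_inverse_eq scaleC_scaleC)
qed

text \<open>With \<open>Y = T\<^sub>t T\<^sub>s\<close>, the trace of \<open>X\<^sup>n = V\<^bsub>2n\<^esub> - Y\<^sup>n\<close> is that of \<open>V\<^bsub>2n\<^esub>\<close>.\<close>

lemma compact_trace_bar_st_power:
  assumes "n \<ge> 1"
  shows "compact_trace (bar_st ^ n) = (\<Sum>j<2 * n. (- of_nat q) ^ j) *\<^sub>C HH0_class swap_elem"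
proof -
  obtain k where k: "2 * n = Suc k" using assms by (cases "2 * n") auto
  have "lucas swap_elem (of_nat q) (2 * n) = bar_st ^ n + (T gt * T gs) ^ n"
    unfolding swap_elem_def bar_st_def
    by (rule lucas_even_bar[OF mult_of_nat_commute[symmetric] Hecke_quadratic])
  then have "compact_trace (bar_st ^ n) = compact_trace (lucas swap_elem (of_nat q) (2 * n))"
    using assms by (simp add: compact_trace_linear compact_trace_ts_power)
  then show ?thesis by (simp only: k compact_trace_lucas lessThan_Suc_atMost)
qed

lemma scaleC_power: "(a *\<^sub>C x) ^ n = (a ^ n) *\<^sub>C x ^ n" for x :: 'a
  by (induction n) (simp_all add: scaleC_one mult_scaleC_left mult_scaleC_right scaleC_scaleC mult.commute)

lemma lam_pow_add: "lam_pow (m + n) = lam_pow m * lam_pow n"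
  by (simp add: lam_pow_def mult_single)

lemma lam_pow_nat: "lam_pow (int n) = lam_pow 1 ^ n" "lam_pow (- int n) = lam_pow (- 1) ^ n"
proof (induction n)
  case (Suc n)
  show "lam_pow (int (Suc n)) = lam_pow 1 ^ Suc n"
    using Suc lam_pow_add[of 1 "int n"] by simp
  show "lam_pow (- int (Suc n)) = lam_pow (- 1) ^ Suc n"
    using Suc lam_pow_add[of "- 1" "- int n"] by simp
qed (simp_all add: lam_pow_def)

lemma algebra_hom_power: "algebra_hom f \<Longrightarrow> f (x ^ n) = f x ^ n"
  by (induction n) (simp_all add: algebra_hom_def)

lemma ind_hom_lam_pow:
  assumes "q > 0"
  shows "ind_hom q T (lam_pow (int n)) = inverse (of_nat q) ^ n *\<^sub>C bar_st ^ n"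
    "ind_hom q T (lam_pow (- int n)) = inverse (of_nat q) ^ n *\<^sub>C (T gt * T gs) ^ n"
proof -
  have hom: "algebra_hom (ind_hom q T)"
    and one: "ind_hom q T (lam_pow 1) = inverse (of_nat q) *\<^sub>C bar_st"
    using theI'[OF ind_hom_exists_unique[OF assms], folded ind_hom_def]
    by (simp_all add: q_ring_inverse_T_ts[OF assms])
  have "lam_pow 1 * lam_pow (- 1) = 1"
    by (simp add: lam_pow_def mult_single)
  then have "ind_hom q T (lam_pow 1) * ind_hom q T (lam_pow (- 1)) = 1"
    using hom by (metis algebra_hom_def)
  then have "(inverse (of_nat q) *\<^sub>C (T gt * T gs)) * (inverse (of_nat q) *\<^sub>C bar_st) * ind_hom q T (lam_pow (- 1))
      = inverse (of_nat q) *\<^sub>C (T gt * T gs)"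
    by (simp add: one mult.assoc)
  moreover have "inverse (of_nat q) * (inverse (of_nat q) * (of_nat q * of_nat q)) = (1 :: complex)"
    using assms by (simp add: field_simps)
  ultimately have minus_one: "ind_hom q T (lam_pow (- 1)) = inverse (of_nat q) *\<^sub>C (T gt * T gs)"
    by (simp add: mult_scaleC_left mult_scaleC_right bar_st_mult scaleC_scaleC scaleC_one)
  show "ind_hom q T (lam_pow (int n)) = inverse (of_nat q) ^ n *\<^sub>C bar_st ^ n"
    "ind_hom q T (lam_pow (- int n)) = inverse (of_nat q) ^ n *\<^sub>C (T gt * T gs) ^ n"
    by (simp_all only: lam_pow_nat algebra_hom_power[OF hom] one minus_one scaleC_power)
qed

lemma one_Gc_ind_lam_pow:
  assumes "q > 0"
  shows "n \<ge> 1 \<Longrightarrow> one_Gc T (ind q T (lam_pow (int n))) =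
      (inverse (of_nat q) ^ n * (\<Sum>j<2 * n. (- of_nat q) ^ j)) *\<^sub>C HH0_class swap_elem"
    and "n \<ge> 1 \<Longrightarrow> one_Gc T (ind q T (lam_pow (- int n))) = 0"
    and "one_Gc T (ind q T (lam_pow 0)) = ind q T (lam_pow 0)"
proof -
  have ind: "one_Gc T (ind q T f) = compact_trace (ind_hom q T f)" for f
    by (simp add: ind_def compact_trace_def)
  show "n \<ge> 1 \<Longrightarrow> one_Gc T (ind q T (lam_pow (int n))) =
      (inverse (of_nat q) ^ n * (\<Sum>j<2 * n. (- of_nat q) ^ j)) *\<^sub>C HH0_class swap_elem"
    by (simp add: ind ind_hom_lam_pow[OF assms] compact_trace_linear compact_trace_bar_st_power scaleC_scaleC)
  show "n \<ge> 1 \<Longrightarrow> one_Gc T (ind q T (lam_pow (- int n))) = 0"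
    by (simp add: ind ind_hom_lam_pow[OF assms] compact_trace_linear compact_trace_ts_power)
  show "one_Gc T (ind q T (lam_pow 0)) = ind q T (lam_pow 0)"
    using ind_hom_lam_pow(1)[OF assms, of 0] one_Gc(4) by (simp add: ind_def scaleC_one T_one)
qed

end

section \<open>The commutator\<close>

text \<open>Reversing the order of summation turns the sign \<open>(-1)\<^sup>j\<close> into \<open>-(-1)\<^sup>j\<close>, because there is an
  even number \<open>2 n\<close> of terms.\<close>

lemma R_poly_eq: "R_poly q n = - (of_nat q - 1) * (\<Sum>j<2 * n. (- of_nat q) ^ j)"
proof -
  have "(\<Sum>j<2 * n. (- 1) ^ j * of_nat q ^ (2 * n - 1 - j))
      = (\<Sum>j<2 * n. (- 1) ^ (2 * n - Suc j) * (of_nat q :: complex) ^ j)"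
    by (subst sum.nat_diff_reindex[symmetric]) (rule sum.cong, auto)
  also have "\<dots> = (\<Sum>j<2 * n. - ((- of_nat q) ^ j))"
  proof (rule sum.cong)
    fix j assume "j \<in> {..<2 * n}"
    then have "even (2 * n - Suc j) \<longleftrightarrow> odd j" by auto
    then show "(- 1) ^ (2 * n - Suc j) * (of_nat q :: complex) ^ j = - ((- of_nat q) ^ j)"
      by (cases "even j") simp_all
  qed simp
  finally show ?thesis by (simp add: R_poly_def sum_negf left_diff_distrib)
qed

text \<open>The classes of \<open>0\<close> and \<open>1\<close> differ. This makes both denominators \<open>q\<close> and \<open>q - 1\<close>
  nonzero.\<close>

lemma (in padic_field) card_residue_field_ge_2:
  assumes "finite (residue_field v)"
  shows "card (residue_field v) \<ge> 2"
proof -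
  define r where "r = {(x, y). v x \<le> 1 \<and> v y \<le> 1 \<and> v (x - y) < 1}"
  have v0: "v 0 = 0" and v1: "v 1 = 1"
    using v_eq_0_iff[of 0] v_of_int[of 1] by simp_all
  have "0 \<in> r `` {0}" "0 \<notin> r `` {1}"
    by (simp_all add: r_def v0 v1)
  then have "card {r `` {0}, r `` {1}} = 2"
    by (subst card_2_iff) blast
  moreover have "{r `` {0}, r `` {1}} \<subseteq> residue_field v"
    by (auto simp: residue_field_def v0 v1 intro!: quotientI simp flip: r_def)
  ultimately show ?thesis
    using card_mono[OF assms] by metis
qed

lemma one_Mc_lam_pow: "one_Mc (lam_pow n) = (if n = 0 then lam_pow 0 else 0)"
  by (simp add: one_Mc_def lam_pow_def lookup_single)

theorem proposition3p21:
  fixes p q :: nat and v :: "'f::field \<Rightarrow> real"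
    and T :: "weyl \<Rightarrow> 'a::complex_algebra_1"
  assumes F: "padic_field p v"
    and residue_field: "finite (residue_field v)" "card (residue_field v) = q"
    and A: "iwahori_hecke q T"
  shows "(\<forall>n::nat. n \<ge> 1 \<longrightarrow>
           one_Gc T (ind q T (lam_pow (int n))) - ind q T (one_Mc (lam_pow (int n))) =
           (R_poly q n / (of_nat q ^ n * (of_nat q - 1))) *\<^sub>C
             HH0_class ((of_nat q - 1) *\<^sub>C 1 - T gs - T gt)) \<and>
         (\<forall>n::int. n < 1 \<longrightarrow>
           one_Gc T (ind q T (lam_pow n)) - ind q T (one_Mc (lam_pow n)) = 0)"
proof -
  interpret iwahori_hecke q T by (fact A)
  have q: "q \<ge> 2"
    using padic_field.card_residue_field_ge_2[OF F residue_field(1)] residue_field(2) by simp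
  then have q0: "q > 0" and q1: "(of_nat q :: complex) \<noteq> 1" by auto
  have "algebra_hom (ind_hom q T)"
    using theI'[OF ind_hom_exists_unique[OF q0], folded ind_hom_def] by blast
  then have "ind q T 0 = HH0_class 0"
    unfolding ind_def algebra_hom_def by (metis complex_vector.linear_0)
  then have ind_0: "ind q T 0 = 0"
    by (simp add: complex_vector.linear_0[OF clinear_HH0_class])
  have B: "HH0_class ((of_nat q - 1) *\<^sub>C 1 - T gs - T gt) = - HH0_class swap_elem"
  proof -
    have "(of_nat q - 1) *\<^sub>C 1 - T gs - T gt = - swap_elem"
      by (simp add: swap_elem_def complex_vector.scale_left_diff_distrib scaleC_one flip: of_nat_mult[of 1])
    then show ?thesis
      by (simp add: complex_vector.linear_neg[OF clinear_HH0_class])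
  qed
  show ?thesis
  proof (intro conjI allI impI)
    fix n :: nat assume n: "n \<ge> 1"
    then have "one_Mc (lam_pow (int n)) = 0" by (simp add: one_Mc_lam_pow)
    moreover have "R_poly q n / (of_nat q ^ n * (of_nat q - 1))
        = - (inverse (of_nat q) ^ n * (\<Sum>j<2 * n. (- of_nat q) ^ j))"
      using q0 q1 by (simp add: R_poly_eq field_simps)
    ultimately show "one_Gc T (ind q T (lam_pow (int n))) - ind q T (one_Mc (lam_pow (int n))) =
        (R_poly q n / (of_nat q ^ n * (of_nat q - 1))) *\<^sub>C
          HH0_class ((of_nat q - 1) *\<^sub>C 1 - T gs - T gt)"
      by (simp add: one_Gc_ind_lam_pow(1)[OF q0 n] B ind_0)
  next
    fix n :: int assume n: "n < 1"
    show "one_Gc T (ind q T (lam_pow n)) - ind q T (one_Mc (lam_pow n)) = 0"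
    proof (cases "n = 0")
      case True
      then show ?thesis by (simp add: one_Mc_lam_pow one_Gc_ind_lam_pow(3)[OF q0])
    next
      case False
      then have "n = - int (nat (- n))" "nat (- n) \<ge> 1" using n by auto
      then have "one_Gc T (ind q T (lam_pow n)) = 0"
        using one_Gc_ind_lam_pow(2)[OF q0] by metis
      then show ?thesis using False by (simp add: one_Mc_lam_pow ind_0)
    qed
  qed
qed

end
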